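(* Let $n$ be a positive integer and let $QG(n)$ denote the number of isomorphism classes of right quasigroups with identity of order $n$. Then $$QG(n)=\frac{1}{|\Sigma_{n-1}|}\sum_{t} a_t\, c_{t^1}^{\,r_{t,1}}\, c_{t^2}^{\,r_{t,2}}\cdots c_{t^{n-1}}^{\,r_{t,n-1}},$$ where $t$ runs over the set of all conjugacy classes of the symmetric group $\Sigma_{n-1}$; for each such $t$ and each $k\in\{1,\ldots,n-1\}$, $t^k$ denotes the conjugacy class in $\Sigma_{n-1}$ of $\sigma^k$ for any $\sigma\in t$; $a_t=|t|$ is the number of elements of $t$; for any conjugacy class $s$ of $\Sigma_{n-1}$, $c_s=|C_{\Sigma_{n-1}}(\sigma)|$ is the order of the centralizer in $\Sigma_{n-1}$ of any $\sigma\in s$; and $r_{t,k}$ is the number of cycles of length $k$ (cycles of length one included) in the decomposition of any element of $t$ as a product of disjoint cycles.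
   Context: A non-empty set $S$ with a binary operation $\circ$ is a right quasigroup if for every pair $a,b\in S$ there exists a unique $x\in S$ such that $x\circ a=b$. It is a right quasigroup with identity if moreover there exists $e\in S$ with $e\circ a=a=a\circ e$ for all $a\in S$ (such an $e$ is unique). The order of $S$ is the cardinality of the set $S$. Two right quasigroups with identity $S$ and $T$ are isomorphic if there is a bijection $f:S\to T$ with $f(x\circ y)=f(x)\circ f(y)$ for all $x,y\in S$. $\Sigma_m$ denotes the group of all permutations of $\{1,\ldots,m\}$. The elements of a conjugacy class $t$ of $\Sigma_{n-1}$ all have the same cycle type, so that $r_{t,1}+2r_{t,2}+\cdots+(n-1)r_{t,n-1}=n-1$, where each permutation is viewed as acting on $\{1,\ldots,n-1\}$. *)

theory Defs
  imports Complex_Main "HOL-Algebra.Sym_Groups" "HOL-Combinatorics.Orbits"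
begin

section \<open>Right quasigroups with identity\<close>

definition right_quasigroup :: "'a set \<Rightarrow> ('a \<Rightarrow> 'a \<Rightarrow> 'a) \<Rightarrow> bool" where
  "right_quasigroup S f \<longleftrightarrow>
     S \<noteq> {} \<and> (\<forall>a\<in>S. \<forall>b\<in>S. f a b \<in> S) \<and>
     (\<forall>a\<in>S. \<forall>b\<in>S. \<exists>!x. x \<in> S \<and> f x a = b)"

definition right_quasigroup_with_identity :: "'a set \<Rightarrow> ('a \<Rightarrow> 'a \<Rightarrow> 'a) \<Rightarrow> bool" where
  "right_quasigroup_with_identity S f \<longleftrightarrow>
     right_quasigroup S f \<and> (\<exists>e\<in>S. \<forall>a\<in>S. f e a = a \<and> f a e = a)"

definition isomorphic :: "'a set \<Rightarrow> ('a \<Rightarrow> 'a \<Rightarrow> 'a) \<Rightarrow> 'b set \<Rightarrow> ('b \<Rightarrow> 'b \<Rightarrow> 'b) \<Rightarrow> bool" where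
  "isomorphic S f T g \<longleftrightarrow>
     (\<exists>h. bij_betw h S T \<and> (\<forall>x\<in>S. \<forall>y\<in>S. h (f x y) = g (h x) (h y)))"

text \<open>
  The structures of order \<open>n\<close> form a proper class; those whose carrier is a set of natural numbers
  meet every isomorphism class (lemma \<open>right_quasigroup_nat_copy\<close>). The values of the operation
  outside the carrier are arbitrary, but they do not affect isomorphism.
\<close>
definition rqi_of_order :: "nat \<Rightarrow> (nat set \<times> (nat \<Rightarrow> nat \<Rightarrow> nat)) set" where
  "rqi_of_order n = {(S, f). right_quasigroup_with_identity S f \<and> finite S \<and> card S = n}"

definition rqi_iso_rel :: "nat \<Rightarrow> ((nat set \<times> (nat \<Rightarrow> nat \<Rightarrow> nat)) \<times> (nat set \<times> (nat \<Rightarrow> nat \<Rightarrow> nat))) set" where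
  "rqi_iso_rel n = {((S, f), (T, g)).
     (S, f) \<in> rqi_of_order n \<and> (T, g) \<in> rqi_of_order n \<and> isomorphic S f T g}"

definition QG :: "nat \<Rightarrow> nat" where
  "QG n = card (rqi_of_order n // rqi_iso_rel n)"

lemma isomorphic_refl: "isomorphic S f S f"
  unfolding isomorphic_def by (rule exI[of _ id]) auto

lemma isomorphic_sym:
  assumes "isomorphic S f T g" and closed: "\<And>a b. a \<in> S \<Longrightarrow> b \<in> S \<Longrightarrow> f a b \<in> S"
  shows "isomorphic T g S f"
proof -
  obtain h where h: "bij_betw h S T" "\<And>x y. x \<in> S \<Longrightarrow> y \<in> S \<Longrightarrow> h (f x y) = g (h x) (h y)"
    using assms(1) unfolding isomorphic_def by blast
  let ?k = "inv_into S h"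
  have k: "bij_betw ?k T S"
    using h(1) by (rule bij_betw_inv_into)
  have "?k (g x y) = f (?k x) (?k y)" if "x \<in> T" "y \<in> T" for x y
  proof -
    have "?k x \<in> S" "?k y \<in> S"
      using k that by (auto dest: bij_betwE)
    moreover have "h (?k x) = x" "h (?k y) = y"
      using h(1) that by (auto simp: bij_betw_inv_into_right)
    ultimately have "g x y = h (f (?k x) (?k y))" "f (?k x) (?k y) \<in> S"
      using h(2) closed by auto
    then show ?thesis
      using h(1) by (simp add: bij_betw_inv_into_left)
  qed
  then show ?thesis
    unfolding isomorphic_def using k by blast
qed

lemma isomorphic_trans:
  assumes "isomorphic S f T g" "isomorphic T g U k"
  shows "isomorphic S f U k"
proof -
  obtain h where h: "bij_betw h S T" "\<And>x y. x \<in> S \<Longrightarrow> y \<in> S \<Longrightarrow> h (f x y) = g (h x) (h y)"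
    using assms(1) unfolding isomorphic_def by blast
  obtain h' where h': "bij_betw h' T U" "\<And>x y. x \<in> T \<Longrightarrow> y \<in> T \<Longrightarrow> h' (g x y) = k (h' x) (h' y)"
    using assms(2) unfolding isomorphic_def by blast
  have "\<forall>x\<in>S. \<forall>y\<in>S. (h' \<circ> h) (f x y) = k ((h' \<circ> h) x) ((h' \<circ> h) y)"
    using h h' by (auto dest: bij_betwE)
  then show ?thesis
    unfolding isomorphic_def using bij_betw_trans[OF h(1) h'(1)] by blast
qed

lemma equiv_rqi_iso_rel: "equiv (rqi_of_order n) (rqi_iso_rel n)"
proof (rule equivI)
  show "rqi_iso_rel n \<subseteq> rqi_of_order n \<times> rqi_of_order n"
    by (auto simp: rqi_iso_rel_def)
  show "refl_on (rqi_of_order n) (rqi_iso_rel n)"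
    by (auto simp: refl_on_def rqi_iso_rel_def isomorphic_refl)
  show "sym (rqi_iso_rel n)"
    unfolding sym_def rqi_iso_rel_def
    by (auto simp: rqi_of_order_def right_quasigroup_with_identity_def right_quasigroup_def
        intro!: isomorphic_sym)
  show "trans (rqi_iso_rel n)"
    unfolding trans_def rqi_iso_rel_def by (auto intro: isomorphic_trans)
qed

lemma right_quasigroup_nat_copy:
  assumes S: "right_quasigroup_with_identity S f" and fin: "finite S"
  obtains T g where "(T, g) \<in> rqi_of_order (card S)" "isomorphic S f T g"
proof -
  obtain h where h: "bij_betw h S {0..<card S}"
    using ex_bij_betw_finite_nat[OF fin] by blast
  define T where "T = {0..<card S}"
  let ?k = "inv_into S h"
  define g where "g x y = h (f (?k x) (?k y))" for x y
  have k: "?k (h x) = x" "h x \<in> T" if "x \<in> S" for x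
    using h that by (auto simp: bij_betw_inv_into_left T_def dest: bij_betwE)
  have k': "h (?k x) = x" "?k x \<in> S" if "x \<in> T" for x
    using h that bij_betw_inv_into[OF h]
    by (auto simp: bij_betw_inv_into_right T_def dest: bij_betwE)
  have closed: "f a b \<in> S" if "a \<in> S" "b \<in> S" for a b
    using S that by (auto simp: right_quasigroup_with_identity_def right_quasigroup_def)
  obtain e where e: "e \<in> S" "\<And>a. a \<in> S \<Longrightarrow> f e a = a \<and> f a e = a"
    using S by (auto simp: right_quasigroup_with_identity_def)
  have ex: "\<exists>!x. x \<in> T \<and> g x a = b" if ab: "a \<in> T" "b \<in> T" for a b
  proof -
    have "\<exists>!x. x \<in> S \<and> f x (?k a) = ?k b"
      using S k'(2)[OF ab(1)] k'(2)[OF ab(2)]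
      by (simp add: right_quasigroup_with_identity_def right_quasigroup_def)
    then obtain x where x: "x \<in> S" "f x (?k a) = ?k b"
        "\<And>y. y \<in> S \<Longrightarrow> f y (?k a) = ?k b \<Longrightarrow> y = x"
      by blast
    show ?thesis
    proof (rule ex1I[of _ "h x"])
      show "h x \<in> T \<and> g (h x) a = b"
        unfolding g_def by (simp only: k[OF x(1)] x(2) k'(1)[OF ab(2)] simp_thms)
      fix y assume y: "y \<in> T \<and> g y a = b"
      then have "h (f (?k y) (?k a)) = b" "f (?k y) (?k a) \<in> S"
        using closed k'(2) ab(1) by (auto simp only: g_def)
      then have "f (?k y) (?k a) = ?k b"
        using k(1)[of "f (?k y) (?k a)"] by simp
      then have "?k y = x"
        using x(3) k'(2) y by blast
      then show "y = h x"
        using k'(1)[of y] y by simp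
    qed
  qed
  have "right_quasigroup_with_identity T g"
    unfolding right_quasigroup_with_identity_def right_quasigroup_def
  proof (intro conjI ballI ex bexI[of _ "h e"])
    show "T \<noteq> {}" "h e \<in> T"
      using e k by auto
    show "g a b \<in> T" if "a \<in> T" "b \<in> T" for a b
      using k k' closed that by (simp add: g_def)
    show "g (h e) a = a" "g a (h e) = a" if "a \<in> T" for a
      using k(1)[OF e(1)] e(2)[OF k'(2)[OF that]] k'(1)[OF that] by (simp_all add: g_def)
  qed
  then have "(T, g) \<in> rqi_of_order (card S)"
    by (simp add: rqi_of_order_def T_def)
  moreover have "isomorphic S f T g"
    unfolding isomorphic_def T_def using h k(1) by (auto intro!: exI[of _ h] simp: g_def)
  ultimately show ?thesis
    by (rule that)
qed


section \<open>Conjugacy classes, their powers and centralizers\<close>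

definition conj_class :: "('a, 'b) monoid_scheme \<Rightarrow> 'a \<Rightarrow> 'a set" where
  "conj_class G x = {g \<otimes>\<^bsub>G\<^esub> x \<otimes>\<^bsub>G\<^esub> inv\<^bsub>G\<^esub> g | g. g \<in> carrier G}"

definition conj_classes :: "('a, 'b) monoid_scheme \<Rightarrow> 'a set set" where
  "conj_classes G = conj_class G ` carrier G"

definition class_power :: "('a, 'b) monoid_scheme \<Rightarrow> 'a set \<Rightarrow> nat \<Rightarrow> 'a set" where
  "class_power G t k = (THE s. \<exists>x\<in>t. s = conj_class G (x [^]\<^bsub>G\<^esub> k))"

definition centralizer :: "('a, 'b) monoid_scheme \<Rightarrow> 'a \<Rightarrow> 'a set" where
  "centralizer G x = {g \<in> carrier G. g \<otimes>\<^bsub>G\<^esub> x = x \<otimes>\<^bsub>G\<^esub> g}"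

definition centralizer_order :: "('a, 'b) monoid_scheme \<Rightarrow> 'a set \<Rightarrow> nat" where
  "centralizer_order G s = (THE c. \<exists>x\<in>s. c = card (centralizer G x))"

context group
begin

lemma conj_class_self: "x \<in> carrier G \<Longrightarrow> x \<in> conj_class G x"
  unfolding conj_class_def by (rule CollectI, rule exI[of _ \<one>]) auto

lemma conj_mult:
  assumes "g \<in> carrier G" "x \<in> carrier G" "y \<in> carrier G"
  shows "(g \<otimes> x \<otimes> inv g) \<otimes> (g \<otimes> y \<otimes> inv g) = g \<otimes> (x \<otimes> y) \<otimes> inv g"
proof -
  have "inv g \<otimes> (g \<otimes> (y \<otimes> inv g)) = y \<otimes> inv g"
    using assms by (simp add: m_assoc[symmetric])
  then show ?thesis
    using assms by (simp add: m_assoc)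
qed

lemma conj_pow:
  assumes "g \<in> carrier G" "x \<in> carrier G"
  shows "(g \<otimes> x \<otimes> inv g) [^] (k::nat) = g \<otimes> x [^] k \<otimes> inv g"
  using assms by (induction k) (simp_all add: conj_mult)

lemma inv_conj:
  assumes "g \<in> carrier G" "x \<in> carrier G"
  shows "inv g \<otimes> (g \<otimes> x \<otimes> inv g) \<otimes> inv (inv g) = x"
proof -
  have "inv g \<otimes> (g \<otimes> x) = x"
    using assms by (simp add: m_assoc[symmetric])
  then show ?thesis
    using assms by (simp add: m_assoc)
qed

lemma conj_class_conj:
  assumes g: "g \<in> carrier G" and x: "x \<in> carrier G"
  shows "conj_class G (g \<otimes> x \<otimes> inv g) = conj_class G x"
proof -
  have sub: "conj_class G (h \<otimes> y \<otimes> inv h) \<subseteq> conj_class G y"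
    if h: "h \<in> carrier G" and y: "y \<in> carrier G" for h y
  proof
    fix z assume "z \<in> conj_class G (h \<otimes> y \<otimes> inv h)"
    then obtain u where "u \<in> carrier G" "z = u \<otimes> (h \<otimes> y \<otimes> inv h) \<otimes> inv u"
      by (auto simp: conj_class_def)
    then have "z = (u \<otimes> h) \<otimes> y \<otimes> inv (u \<otimes> h)" "u \<otimes> h \<in> carrier G"
      using h y by (simp_all add: m_assoc inv_mult_group)
    then show "z \<in> conj_class G y"
      by (auto simp: conj_class_def)
  qed
  have "conj_class G x \<subseteq> conj_class G (g \<otimes> x \<otimes> inv g)"
    using sub[of "inv g" "g \<otimes> x \<otimes> inv g"] inv_conj[OF g x] g x by simp
  with sub[OF g x] show ?thesis
    by blast
qed

lemma conj_classE:
  assumes "t \<in> conj_classes G" "x \<in> t" "y \<in> t"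
  obtains g where "g \<in> carrier G" "x \<in> carrier G" "y = g \<otimes> x \<otimes> inv g"
proof -
  obtain z where z: "z \<in> carrier G" "t = conj_class G z"
    using assms(1) by (auto simp: conj_classes_def)
  obtain u where u: "u \<in> carrier G" "x = u \<otimes> z \<otimes> inv u"
    using assms(2) z by (auto simp: conj_class_def)
  have "t = conj_class G x"
    using conj_class_conj u z by simp
  then show ?thesis
    using assms(3) that u z by (auto simp: conj_class_def)
qed

lemma class_power_eq:
  assumes "t \<in> conj_classes G" "x \<in> t"
  shows "class_power G t k = conj_class G (x [^] k)"
  unfolding class_power_def
proof (rule the_equality)
  show "\<exists>y\<in>t. conj_class G (x [^] k) = conj_class G (y [^] k)"
    using assms(2) by blast
  fix s assume "\<exists>y\<in>t. s = conj_class G (y [^] k)"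
  then obtain y where y: "y \<in> t" "s = conj_class G (y [^] k)"
    by blast
  show "s = conj_class G (x [^] k)"
    using conj_classE[OF assms y(1)] y(2) by (metis conj_pow conj_class_conj nat_pow_closed)
qed

lemma card_centralizer_conj:
  assumes g: "g \<in> carrier G" and x: "x \<in> carrier G"
  shows "card (centralizer G (g \<otimes> x \<otimes> inv g)) = card (centralizer G x)"
proof -
  define \<phi> where "\<phi> h y = h \<otimes> y \<otimes> inv h" for h y
  have closed: "\<phi> h y \<in> carrier G" if "h \<in> carrier G" "y \<in> carrier G" for h y
    using that by (simp add: \<phi>_def)
  have cent: "\<phi> h y \<in> centralizer G (\<phi> h z)"
    if "h \<in> carrier G" "z \<in> carrier G" "y \<in> centralizer G z" for h y z
    using that closed unfolding centralizer_def by (auto simp: \<phi>_def conj_mult)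
  have undo: "\<phi> (inv h) (\<phi> h y) = y" if "h \<in> carrier G" "y \<in> carrier G" for h y
    using inv_conj[OF that] by (simp add: \<phi>_def)
  have "bij_betw (\<phi> g) (centralizer G x) (centralizer G (\<phi> g x))"
  proof (rule bij_betw_byWitness[where f' = "\<phi> (inv g)"])
    show "\<forall>a\<in>centralizer G x. \<phi> (inv g) (\<phi> g a) = a"
      using undo[OF g] by (auto simp: centralizer_def)
    show "\<forall>a\<in>centralizer G (\<phi> g x). \<phi> g (\<phi> (inv g) a) = a"
      using undo[of "inv g"] g by (auto simp: centralizer_def)
    show "\<phi> g ` centralizer G x \<subseteq> centralizer G (\<phi> g x)"
      using cent g x by blast
    show "\<phi> (inv g) ` centralizer G (\<phi> g x) \<subseteq> centralizer G x"
      using cent[of "inv g" "\<phi> g x"] undo[OF g x] closed[OF g x] g by auto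
  qed
  then show ?thesis
    unfolding \<phi>_def by (simp add: bij_betw_same_card)
qed

lemma centralizer_order_eq:
  assumes "s \<in> conj_classes G" "x \<in> s"
  shows "centralizer_order G s = card (centralizer G x)"
  unfolding centralizer_order_def
proof (rule the_equality)
  show "\<exists>y\<in>s. card (centralizer G x) = card (centralizer G y)"
    using assms(2) by blast
  fix c assume "\<exists>y\<in>s. c = card (centralizer G y)"
  then obtain y where y: "y \<in> s" "c = card (centralizer G y)"
    by blast
  show "c = card (centralizer G x)"
    using conj_classE[OF assms y(1)] y(2) by (metis card_centralizer_conj)
qed

end


section \<open>Cycle types\<close>

text \<open>
  The lists in \<open>css\<close> are the cycles of \<open>p\<close> written out; every point of \<open>A\<close> occurs exactly once, so a
  fixed point contributes a list of length one, whose \<^const>\<open>cycle_of_list\<close> is the identity.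
\<close>
definition disjoint_cycles :: "'a set \<Rightarrow> ('a \<Rightarrow> 'a) \<Rightarrow> 'a list list \<Rightarrow> bool" where
  "disjoint_cycles A p css \<longleftrightarrow>
     [] \<notin> set css \<and> distinct (concat css) \<and> set (concat css) = A \<and>
     p = foldr (\<circ>) (map cycle_of_list css) id"

definition num_cycles :: "'a set \<Rightarrow> ('a \<Rightarrow> 'a) \<Rightarrow> nat \<Rightarrow> nat" where
  "num_cycles A p k =
     (THE r. \<exists>css. disjoint_cycles A p css \<and> r = length (filter (\<lambda>cs. length cs = k) css))"

definition class_num_cycles :: "'a set \<Rightarrow> ('a \<Rightarrow> 'a) set \<Rightarrow> nat \<Rightarrow> nat" where
  "class_num_cycles A t k = (THE r. \<exists>p\<in>t. r = num_cycles A p k)"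

lemma disjoint_cycles_exists:
  assumes "p permutes A" "finite A"
  shows "\<exists>css. disjoint_cycles A p css"
  using cycle_decomposition[OF assms]
proof (induction rule: cycle_decomp.induct)
  case empty
  then show ?case
    by (intro exI[of _ "[]"]) (simp add: disjoint_cycles_def id_def)
next
  case (comp I p cs)
  then obtain css where css: "disjoint_cycles I p css"
    by blast
  show ?case
  proof (cases "cs = []")
    case True
    then show ?thesis
      using css by auto
  next
    case False
    then show ?thesis
      using css comp.hyps
      by (intro exI[of _ "cs # css"]) (auto simp: disjoint_cycles_def)
  qed
qed

lemma foldr_cycles_Cons:
  "foldr (\<circ>) (map f (a # as)) id x = f a (foldr (\<circ>) (map f as) id x)"
  by simp

lemma foldr_cycles_outside:
  "x \<notin> set (concat css) \<Longrightarrow> foldr (\<circ>) (map cycle_of_list css) id x = x"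
  by (induction css) (auto simp: id_outside_supp)

lemma foldr_cycles_inside:
  assumes "distinct (concat css)" "cs \<in> set css" "x \<in> set cs"
  shows "foldr (\<circ>) (map cycle_of_list css) id x = cycle_of_list cs x"
  using assms
proof (induction css)
  case (Cons a css)
  show ?case
  proof (cases "x \<in> set a")
    case True
    then have "cs = a"
      using Cons.prems by auto
    moreover have "x \<notin> set (concat css)"
      using Cons.prems True by auto
    ultimately show ?thesis
      using foldr_cycles_outside[of x css] by (simp only: foldr_cycles_Cons not_False_eq_True)
  next
    case False
    then have cs: "cs \<in> set css"
      using Cons.prems by auto
    have "cycle_of_list cs x \<in> set cs"
      using permutes_in_image[OF cycle_permutes[of cs]] Cons.prems by simp
    then have "cycle_of_list cs x \<notin> set a"
      using Cons.prems cs by auto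
    then have "cycle_of_list a (cycle_of_list cs x) = cycle_of_list cs x"
      by (rule id_outside_supp)
    then show ?thesis
      using Cons cs
      by (simp only: foldr_cycles_Cons id_outside_supp concat.simps distinct_append)
  qed
qed simp

lemma cyclic_on_cycle_of_list:
  assumes "distinct cs" "cs \<noteq> []"
  shows "cyclic_on (cycle_of_list cs) (set cs)"
proof -
  let ?c = "cycle_of_list cs"
  have pow: "(?c ^^ n) (cs ! 0) = cs ! (n mod length cs)" for n
  proof -
    have "(?c ^^ n) (cs ! 0) = map (?c ^^ n) cs ! 0"
      using assms by simp
    also have "\<dots> = rotate n cs ! 0"
      using cyclic_rotation[OF assms(1)] by simp
    also have "\<dots> = cs ! (n mod length cs)"
      using assms by (simp add: nth_rotate)
    finally show ?thesis .
  qed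
  have "set cs \<subseteq> Orbits.orbit ?c (cs ! 0)"
  proof
    fix x assume "x \<in> set cs"
    then obtain i where i: "i < length cs" "x = cs ! i"
      by (auto simp: in_set_conv_nth)
    then have "x = (?c ^^ (i + length cs)) (cs ! 0)"
      unfolding pow by simp
    moreover have "0 < i + length cs"
      using assms by simp
    ultimately show "x \<in> Orbits.orbit ?c (cs ! 0)"
      unfolding Orbits.orbit_altdef by blast
  qed
  moreover have "Orbits.orbit ?c (cs ! 0) \<subseteq> set cs"
    using assms by (auto simp: Orbits.orbit_altdef pow)
  ultimately show ?thesis
    unfolding cyclic_on_def using assms by (intro bexI[of _ "cs ! 0"] equalityI nth_mem) simp_all
qed

lemma disjoint_cycles_image:
  assumes css: "disjoint_cycles A p css"
  shows "set ` set css = {C. C \<subseteq> A \<and> cyclic_on p C}"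
proof -
  have cyc: "cyclic_on p (set cs)" if "cs \<in> set css" for cs
  proof -
    have "distinct cs" "cs \<noteq> []"
      using css that by (auto simp: disjoint_cycles_def distinct_concat_iff)
    moreover have "p x = cycle_of_list cs x" if "x \<in> set cs" for x
      using css \<open>cs \<in> set css\<close> that foldr_cycles_inside by (auto simp: disjoint_cycles_def)
    ultimately show ?thesis
      using cyclic_on_cycle_of_list[of cs] cyclic_cong[of "set cs" p "cycle_of_list cs"] by simp
  qed
  show ?thesis
  proof (intro equalityI subsetI)
    fix C assume "C \<in> set ` set css"
    then show "C \<in> {C. C \<subseteq> A \<and> cyclic_on p C}"
      using css cyc by (auto simp: disjoint_cycles_def)
  next
    fix C assume "C \<in> {C. C \<subseteq> A \<and> cyclic_on p C}"
    then have C: "C \<subseteq> A" "cyclic_on p C"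
      by auto
    then obtain x where x: "x \<in> C"
      by (auto simp: cyclic_on_def)
    then obtain cs where cs: "cs \<in> set css" "x \<in> set cs"
      using C css by (auto simp: disjoint_cycles_def)
    have "C = Orbits.orbit p x" "set cs = Orbits.orbit p x"
      using orbit_cyclic_eq3[OF C(2) x] orbit_cyclic_eq3[OF cyc[OF cs(1)] cs(2)] by simp_all
    then show "C \<in> set ` set css"
      using cs by auto
  qed
qed

lemma num_cycles_unique:
  assumes css: "disjoint_cycles A p css"
  shows "length (filter (\<lambda>cs. length cs = k) css) = card {C. C \<subseteq> A \<and> cyclic_on p C \<and> card C = k}"
proof -
  have dist: "distinct css" and d: "\<And>cs. cs \<in> set css \<Longrightarrow> distinct cs"
    and dj: "\<And>cs cs'. cs \<in> set css \<Longrightarrow> cs' \<in> set css \<Longrightarrow> cs \<noteq> cs' \<Longrightarrow> set cs \<inter> set cs' = {}"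
    using css by (auto simp: disjoint_cycles_def distinct_concat_iff removeAll_id)
  have inj: "inj_on set (set css)"
  proof (rule inj_onI, rule ccontr)
    fix cs cs' assume *: "cs \<in> set css" "cs' \<in> set css" "set cs = set cs'" "cs \<noteq> cs'"
    then have "set cs = {}"
      using dj[of cs cs'] by simp
    then show False
      using * css by (auto simp: disjoint_cycles_def)
  qed
  have "{C. C \<subseteq> A \<and> cyclic_on p C \<and> card C = k} = {C \<in> set ` set css. card C = k}"
    unfolding disjoint_cycles_image[OF css] by auto
  also have "\<dots> = set ` set (filter (\<lambda>cs. length cs = k) css)"
    using d by (auto simp: distinct_card)
  also have "card \<dots> = card (set (filter (\<lambda>cs. length cs = k) css))"
    by (rule card_image) (rule inj_on_subset[OF inj], auto)
  also have "\<dots> = length (filter (\<lambda>cs. length cs = k) css)"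
    using dist by (intro distinct_card distinct_filter)
  finally show ?thesis
    by simp
qed

lemma num_cycles_eq:
  assumes "p permutes A" "finite A"
  shows "num_cycles A p k = card {C. C \<subseteq> A \<and> cyclic_on p C \<and> card C = k}"
proof -
  obtain css where "disjoint_cycles A p css"
    using disjoint_cycles_exists[OF assms] by blast
  then show ?thesis
    unfolding num_cycles_def
    by (intro the_equality exI[of _ css]) (auto simp: num_cycles_unique)
qed

lemma cyclic_on_conj:
  assumes g: "bij g" and "cyclic_on p C"
  shows "cyclic_on (g \<circ> p \<circ> inv' g) (g ` C)"
proof -
  have "((g \<circ> p \<circ> inv' g) ^^ n) (g x) = g ((p ^^ n) x)" for n x
    using g by (induction n) (auto simp: bij_is_inj)
  then have "Orbits.orbit (g \<circ> p \<circ> inv' g) (g x) = g ` Orbits.orbit p x" for x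
    by (auto simp: Orbits.orbit_altdef)
  then show ?thesis
    using assms(2) by (auto simp: cyclic_on_def)
qed

lemma num_cycles_conj:
  assumes g: "g permutes A" and p: "p permutes A" and fin: "finite A"
  shows "num_cycles A (g \<circ> p \<circ> inv' g) k = num_cycles A p k"
proof -
  have bij: "bij g"
    using g by (rule permutes_bij)
  have inv: "inv' g permutes A" "bij (inv' g)"
    using permutes_inv[OF g] permutes_bij by auto
  have q: "g \<circ> p \<circ> inv' g permutes A"
    using g p inv by (intro permutes_compose)
  have undo: "inv' g \<circ> (g \<circ> p \<circ> inv' g) \<circ> inv' (inv' g) = p"
    using bij by (auto simp: fun_eq_iff inv_inv_eq bij_is_inj)
  have sub: "g ` C \<subseteq> A" if "C \<subseteq> A" for C
    using that g permutes_image by fastforce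
  have sub': "inv' g ` C \<subseteq> A" if "C \<subseteq> A" for C
    using that inv(1) permutes_image by fastforce
  have "bij_betw ((`) g) {C. C \<subseteq> A \<and> cyclic_on p C \<and> card C = k}
      {C. C \<subseteq> A \<and> cyclic_on (g \<circ> p \<circ> inv' g) C \<and> card C = k}"
  proof (rule bij_betw_byWitness[where f' = "(`) (inv' g)"])
    show "(`) g ` {C. C \<subseteq> A \<and> cyclic_on p C \<and> card C = k}
        \<subseteq> {C. C \<subseteq> A \<and> cyclic_on (g \<circ> p \<circ> inv' g) C \<and> card C = k}"
      using sub cyclic_on_conj[OF bij]
      by (auto simp: card_image[OF inj_on_subset[OF bij_is_inj[OF bij] subset_UNIV]])
    show "(`) (inv' g) ` {C. C \<subseteq> A \<and> cyclic_on (g \<circ> p \<circ> inv' g) C \<and> card C = k}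
        \<subseteq> {C. C \<subseteq> A \<and> cyclic_on p C \<and> card C = k}"
      using sub' cyclic_on_conj[OF inv(2), of "g \<circ> p \<circ> inv' g"] unfolding undo
      by (auto simp: card_image[OF inj_on_subset[OF bij_is_inj[OF inv(2)] subset_UNIV]])
  qed (use bij in \<open>auto simp: image_comp bij_is_inj surj_f_inv_f[OF bij_is_surj]\<close>)
  then show ?thesis
    using num_cycles_eq[OF p fin] num_cycles_eq[OF q fin] by (simp add: bij_betw_same_card)
qed

lemma class_num_cycles_eq:
  assumes t: "t \<in> conj_classes (sym_group m)" and p: "p \<in> t"
  shows "class_num_cycles {1..m} t k = num_cycles {1..m} p k"
  unfolding class_num_cycles_def
proof (rule the_equality)
  show "\<exists>q\<in>t. num_cycles {1..m} p k = num_cycles {1..m} q k"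
    using p by blast
  fix r assume "\<exists>q\<in>t. r = num_cycles {1..m} q k"
  then obtain q where q: "q \<in> t" "r = num_cycles {1..m} q k"
    by blast
  obtain g where g: "g \<in> carrier (sym_group m)" "p \<in> carrier (sym_group m)"
      "q = g \<otimes>\<^bsub>sym_group m\<^esub> p \<otimes>\<^bsub>sym_group m\<^esub> inv\<^bsub>sym_group m\<^esub> g"
    using group.conj_classE[OF sym_group_is_group t p q(1)] by blast
  then have "q = g \<circ> p \<circ> inv' g"
    by (simp add: sym_group_mult sym_group_inv_equality)
  then show "r = num_cycles {1..m} p k"
    using q(2) g num_cycles_conj[of g "{1..m}" p k] by (simp add: sym_group_carrier)
qed

end

theory Submission
  imports Defs "HOL-Algebra.Group_Action"
begin

text \<open>
  Write \<open>n = m + 1\<close> and put the identity at \<open>0\<close>, the other elements being \<open>1, \<dots>, m\<close>. A right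
  quasigroup is a family of permutations \<open>R\<^sub>a\<close>, the right translations \<open>x \<mapsto> x \<circ> a\<close>, and \<open>0\<close> is an
  identity iff \<open>R\<^sub>0\<close> is the identity map and \<open>R\<^sub>a\<close> sends \<open>0\<close> to \<open>a\<close>. For \<open>a \<noteq> 0\<close> the permutations with
  \<open>R\<^sub>a 0 = a\<close> form a coset of \<open>\<Sigma>\<^sub>m\<close>: they are the products \<open>(0 a) T\<^sub>a\<close> with \<open>T\<^sub>a\<close> any permutation of
  \<open>{1..m}\<close>. Hence the structures on \<open>{0..m}\<close> with identity \<open>0\<close> are the labellings of \<open>{1..m}\<close> by elements
  of \<open>\<Sigma>\<^sub>m\<close> (\<open>labelled_op_in_rqi\<close>, \<open>rqi_isomorphic_labelled_op\<close>).

  An isomorphism fixes \<open>0\<close>, so it is given by some \<open>\<sigma> \<in> \<Sigma>\<^sub>m\<close>. Because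
  \<open>\<sigma> (0 a) \<sigma>\<inverse> = (0 \<sigma>(a))\<close>, it carries the labelling \<open>T\<close> to the labelling \<open>T'\<close> with
  \<open>T'\<^bsub>\<sigma>(a)\<^esub> = \<sigma> T\<^sub>a \<sigma>\<inverse>\<close>. This is an action of \<open>\<Sigma>\<^sub>m\<close>, and its orbits are the isomorphism classes
  (\<open>QG_eq_card_orbits\<close>), so Burnside's lemma applies.

  A labelling fixed by \<open>\<sigma>\<close> is one with \<open>T\<^bsub>\<sigma>(a)\<^esub> = \<sigma> T\<^sub>a \<sigma>\<inverse>\<close>. On each cycle of \<open>\<sigma>\<close> it is determined by
  its value at one point, and when the cycle has length \<open>k\<close>, returning to that point imposes exactly
  the condition that the value commutes with \<open>\<sigma>\<^sup>k\<close> (\<open>card_equivariant_maps\<close>). So there are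
  \<open>\<Prod>\<^sub>k |C(\<sigma>\<^sup>k)|\<^bsup>r\<^esup>\<close> fixed labellings, where \<open>r\<close> is the number of \<open>k\<close>-cycles
  (\<open>card_invariants_relabel\<close>). This number depends only on the conjugacy class of \<open>\<sigma>\<close>, and collecting
  the terms of Burnside's sum by classes gives the formula.
\<close>

section \<open>Equivariant maps from a permuted set\<close>

lemma cyclic_on_funpow_card:
  assumes "cyclic_on s C" "r \<in> C"
  shows "(s ^^ card C) r = r"
    and "bij_betw (\<lambda>i. (s ^^ i) r) {..<card C} C"
proof -
  let ?d = "funpow_dist1 s r r"
  have C: "C = Orbits.orbit s r"
    using orbit_cyclic_eq3[OF assms] by simp
  then have r: "r \<in> Orbits.orbit s r"
    using assms(2) by simp
  have inj: "inj_on (\<lambda>i. (s ^^ i) r) {0..<?d}"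
    by (rule inj_on_funpow_dist1[OF r])
  have im: "C = (\<lambda>i. (s ^^ i) r) ` {0..<?d}"
    using orbit_conv_funpow_dist1[OF r] C by simp
  then have d: "card C = ?d"
    using card_image[OF inj] by simp
  show "(s ^^ card C) r = r"
    unfolding d by (rule funpow_dist1_prop[OF r])
  show "bij_betw (\<lambda>i. (s ^^ i) r) {..<card C} C"
    unfolding d bij_betw_def lessThan_atLeast0 using inj im by simp
qed

lemma cyclic_on_funpow_eq_mod:
  assumes "cyclic_on s C" "r \<in> C" "(s ^^ i) r = (s ^^ j) r"
  shows "i mod card C = j mod card C"
proof -
  have "card C > 0"
    using assms(2) finite_cyclic_on[OF assms(1)] card_gt_0_iff by blast
  moreover have "(s ^^ (i mod card C)) r = (s ^^ (j mod card C)) r"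
    using assms(3) by (simp add: funpow_mod_eq cyclic_on_funpow_card(1)[OF assms(1,2)])
  ultimately show ?thesis
    using bij_betw_imp_inj_on[OF cyclic_on_funpow_card(2)[OF assms(1,2)]]
    by (auto dest!: inj_onD)
qed

text \<open>
  An equivariant map is the same thing as a free choice, for every cycle \<open>C\<close>, of the value at one
  point of \<open>C\<close>. Going once around the cycle applies \<open>\<phi>\<close> to this value \<open>card C\<close> times and must
  reproduce it; this condition is also sufficient.
\<close>
lemma card_equivariant_maps:
  assumes s: "s permutes A" and fin: "finite A" and \<phi>: "\<phi> \<in> Y \<rightarrow> Y"
  shows "card {f \<in> A \<rightarrow>\<^sub>E Y. \<forall>a\<in>A. f (s a) = \<phi> (f a)} =
    (\<Prod>C | C \<subseteq> A \<and> cyclic_on s C. card {y \<in> Y. (\<phi> ^^ card C) y = y})"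
proof -
  define \<C> where "\<C> = {C. C \<subseteq> A \<and> cyclic_on s C}"
  define rep where "rep C = (SOME r. r \<in> C)" for C :: "'a set"
  define cyc where "cyc a = Orbits.orbit s a" for a
  define idx where "idx a = (SOME i. (s ^^ i) (rep (cyc a)) = a)" for a
  define X where "X = {f \<in> A \<rightarrow>\<^sub>E Y. \<forall>a\<in>A. f (s a) = \<phi> (f a)}"
  define Z where "Z = (\<Pi>\<^sub>E C\<in>\<C>. {y \<in> Y. (\<phi> ^^ card C) y = y})"
  have rep: "rep C \<in> C" "rep C \<in> A" if "C \<in> \<C>" for C
    using that someI_ex[of "\<lambda>r. r \<in> C"] by (auto simp: \<C>_def cyclic_on_def rep_def)
  have cyc: "cyc a \<in> \<C>" if "a \<in> A" for a
    using that permutes_orbit_subset[OF s] cyclic_on_orbit[OF s fin] by (auto simp: \<C>_def cyc_def)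
  have cyc_in: "cyc a = C" if "C \<in> \<C>" "a \<in> C" for a C
    using that orbit_cyclic_eq3[of s C a] by (auto simp: \<C>_def cyc_def)
  have idx: "(s ^^ idx a) (rep (cyc a)) = a" if "a \<in> A" for a
  proof -
    have "a \<in> cyc a"
      using s fin permutation_self_in_orbit[of s a] by (auto simp: cyc_def permutation_permutes)
    then have "\<exists>i. (s ^^ i) (rep (cyc a)) = a"
      using bij_betw_imp_surj_on[OF cyclic_on_funpow_card(2)[of s "cyc a" "rep (cyc a)"]]
        cyc[OF that] rep(1)[OF cyc[OF that]]
      unfolding \<C>_def by (metis (no_types, lifting) imageE mem_Collect_eq)
    then show ?thesis
      unfolding idx_def by (rule someI_ex)
  qed
  have pow_A: "(s ^^ i) a \<in> A" if "a \<in> A" for i a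
    using that permutes_in_image[OF s] by (induction i) auto
  have pow_Y: "(\<phi> ^^ i) y \<in> Y" if "y \<in> Y" for i y
    using that \<phi> by (induction i) auto
  \<comment> \<open>An equivariant map intertwines all the powers.\<close>
  have pow: "f ((s ^^ i) a) = (\<phi> ^^ i) (f a)" if "f \<in> X" "a \<in> A" for f i a
    using that pow_A by (induction i) (auto simp: X_def)
  define F where "F f = (\<lambda>C\<in>\<C>. f (rep C))" for f :: "'a \<Rightarrow> 'b"
  have "inj_on F X"
  proof (rule inj_onI)
    fix f g assume f: "f \<in> X" and g: "g \<in> X" and eq: "F f = F g"
    have "f a = g a" if "a \<in> A" for a
    proof -
      have "f (rep (cyc a)) = g (rep (cyc a))"
        using fun_cong[OF eq, of "cyc a"] cyc[OF that] by (simp add: F_def)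
      then show ?thesis
        using pow[OF f, of "rep (cyc a)" "idx a"] pow[OF g, of "rep (cyc a)" "idx a"]
          rep(2)[OF cyc[OF that]] idx[OF that] by simp
    qed
    then show "f = g"
      using f g PiE_ext[of f A "\<lambda>_. Y" g] by (simp add: X_def)
  qed
  moreover have "F ` X \<subseteq> Z"
  proof (rule image_subsetI)
    fix f assume f: "f \<in> X"
    have "f (rep C) \<in> Y" "(\<phi> ^^ card C) (f (rep C)) = f (rep C)" if "C \<in> \<C>" for C
    proof -
      show "f (rep C) \<in> Y"
        using f rep(2)[OF that] by (auto simp: X_def)
      show "(\<phi> ^^ card C) (f (rep C)) = f (rep C)"
        using pow[OF f rep(2)[OF that], of "card C"]
          cyclic_on_funpow_card(1)[of s C "rep C"] rep(1)[OF that] that by (simp add: \<C>_def)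
    qed
    then show "F f \<in> Z"
      by (auto simp: Z_def F_def)
  qed
  moreover have "Z \<subseteq> F ` X"
  proof
    fix U assume U: "U \<in> Z"
    define f where "f = (\<lambda>a\<in>A. (\<phi> ^^ idx a) (U (cyc a)))"
    have U_Y: "U C \<in> Y" and U_fix: "(\<phi> ^^ card C) (U C) = U C" if "C \<in> \<C>" for C
      using U that by (auto simp: Z_def)
    \<comment> \<open>The exponent chosen for a point only matters modulo the length of its cycle.\<close>
    have f_pow: "f ((s ^^ i) (rep C)) = (\<phi> ^^ i) (U C)" if C: "C \<in> \<C>" for i C
    proof -
      let ?a = "(s ^^ i) (rep C)"
      have cC: "cyclic_on s C"
        using C by (simp add: \<C>_def)
      have a: "?a \<in> A" "cyc ?a = C"
        using pow_A rep[OF C] cyc_in[OF C] cyclic_on_funpow_in[OF cC] by auto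
      have "idx ?a mod card C = i mod card C"
        using cyclic_on_funpow_eq_mod[OF cC rep(1)[OF C], of "idx ?a" i] idx[OF a(1)] a(2) by simp
      then have "(\<phi> ^^ idx ?a) (U C) = (\<phi> ^^ i) (U C)"
        using funpow_mod_eq[OF U_fix[OF C]] by metis
      then show ?thesis
        using a by (simp add: f_def)
    qed
    have "f (s a) = \<phi> (f a)" if "a \<in> A" for a
      using f_pow[OF cyc[OF that], of "Suc (idx a)"] f_pow[OF cyc[OF that], of "idx a"] idx[OF that]
      by simp
    moreover have "f \<in> A \<rightarrow>\<^sub>E Y"
      using U_Y cyc pow_Y by (auto simp: f_def)
    ultimately have "f \<in> X"
      by (simp add: X_def)
    moreover have "F f = U"
      using f_pow[of _ 0] U by (auto simp: F_def Z_def fun_eq_iff PiE_def extensional_def)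
    ultimately show "U \<in> F ` X"
      by blast
  qed
  ultimately have "bij_betw F X Z"
    by (auto simp: bij_betw_def)
  then have "card X = card Z"
    by (rule bij_betw_same_card)
  also have "\<dots> = (\<Prod>C\<in>\<C>. card {y \<in> Y. (\<phi> ^^ card C) y = y})"
    unfolding Z_def by (rule card_PiE) (use fin in \<open>auto simp: \<C>_def\<close>)
  finally show ?thesis
    by (simp add: X_def \<C>_def)
qed

section \<open>Simultaneous conjugation and relabelling\<close>
definition conj_by :: "('a \<Rightarrow> 'a) \<Rightarrow> ('a \<Rightarrow> 'a) \<Rightarrow> 'a \<Rightarrow> 'a" where
  "conj_by g p = g \<circ> p \<circ> inv' g"

lemma conj_by_permutes:
  "g permutes A \<Longrightarrow> p permutes A \<Longrightarrow> conj_by g p permutes A"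
  unfolding conj_by_def by (intro permutes_compose permutes_inv)

lemma conj_by_comp:
  assumes "bij g" "bij h"
  shows "conj_by g (conj_by h p) = conj_by (g \<circ> h) p"
  using assms by (simp add: conj_by_def o_inv_distrib comp_assoc)

lemma conj_by_funpow:
  assumes "bij g"
  shows "(conj_by g ^^ k) p = conj_by (g ^^ k) p"
proof (induction k)
  case (Suc k)
  then show ?case
    using assms by (simp add: conj_by_comp bij_fn) (simp add: comp_def)
qed (simp add: conj_by_def)

lemma conj_by_fixed_iff:
  assumes "bij g"
  shows "conj_by g p = p \<longleftrightarrow> p \<circ> g = g \<circ> p"
proof
  assume "conj_by g p = p"
  then have "p \<circ> g = g \<circ> p \<circ> inv' g \<circ> g"
    by (simp add: conj_by_def)
  then show "p \<circ> g = g \<circ> p"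
    using assms by (simp add: comp_assoc bij_is_inj)
next
  assume "p \<circ> g = g \<circ> p"
  then have "conj_by g p = p \<circ> (g \<circ> inv' g)"
    by (simp add: conj_by_def comp_assoc[symmetric])
  then show "conj_by g p = p"
    using assms by (simp add: surj_iff[THEN iffD1] bij_is_surj)
qed

lemma sym_group_pow: "x [^]\<^bsub>sym_group m\<^esub> (k::nat) = x ^^ k"
  by (induction k) (simp_all add: sym_group_mult sym_group_one nat_pow_def funpow_Suc_right del: funpow.simps)

definition labellings :: "'a set \<Rightarrow> ('a \<Rightarrow> 'a \<Rightarrow> 'a) set" where
  "labellings A = A \<rightarrow>\<^sub>E {p. p permutes A}"

text \<open>
  Cut off outside the labellings, so that the result lies in \<^const>\<open>BijGroup\<close>, whose elements are
  extensional maps.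
\<close>
definition relabel :: "'a set \<Rightarrow> ('a \<Rightarrow> 'a) \<Rightarrow> ('a \<Rightarrow> 'a \<Rightarrow> 'a) \<Rightarrow> 'a \<Rightarrow> 'a \<Rightarrow> 'a" where
  "relabel A g = (\<lambda>T\<in>labellings A. \<lambda>a\<in>A. conj_by g (T (inv' g a)))"

lemma relabel_closed:
  assumes "g permutes A" "T \<in> labellings A"
  shows "relabel A g T \<in> labellings A"
  using assms permutes_in_image[OF permutes_inv[OF assms(1)]]
  by (auto simp: relabel_def labellings_def PiE_def Pi_def intro!: conj_by_permutes)

lemma relabel_apply:
  assumes "g permutes A" "T \<in> labellings A" "a \<in> A"
  shows "relabel A g T (g a) = conj_by g (T a)"
  using assms by (simp add: relabel_def permutes_in_image permutes_inverses)

text \<open>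
  The action in a form free of inverses; for \<open>T' = T\<close> it says that the fixed points of \<open>g\<close> are
  the equivariant labellings.
\<close>
lemma relabel_eq_iff:
  assumes "g permutes A" "T \<in> labellings A" "T' \<in> labellings A"
  shows "relabel A g T = T' \<longleftrightarrow> (\<forall>a\<in>A. T' (g a) = conj_by g (T a))"
proof
  assume "\<forall>a\<in>A. T' (g a) = conj_by g (T a)"
  then have "relabel A g T (g a) = T' (g a)" if "a \<in> A" for a
    using relabel_apply[OF assms(1,2) that] that by simp
  then have "relabel A g T b = T' b" if "b \<in> A" for b
    using that permutes_inverses(1)[OF assms(1)] permutes_in_image[OF permutes_inv[OF assms(1)]]
    by metis
  then show "relabel A g T = T'"
    using PiE_ext[OF relabel_closed[OF assms(1,2), unfolded labellings_def]
        assms(3)[unfolded labellings_def]] by blast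
qed (use relabel_apply[OF assms(1,2)] in auto)

lemma relabel_id:
  assumes "T \<in> labellings A"
  shows "relabel A id T = T"
  using relabel_eq_iff[of id A T T] assms by (simp add: permutes_id conj_by_def)

lemma relabel_comp:
  assumes g: "g permutes A" and h: "h permutes A" and T: "T \<in> labellings A"
  shows "relabel A (g \<circ> h) T = relabel A g (relabel A h T)"
proof -
  have "relabel A g (relabel A h T) ((g \<circ> h) a) = conj_by (g \<circ> h) (T a)" if "a \<in> A" for a
    using that g h relabel_apply[OF g relabel_closed[OF h T], of "h a"] relabel_apply[OF h T that]
    by (simp add: permutes_in_image conj_by_comp permutes_bij)
  then show ?thesis
    using relabel_eq_iff[OF permutes_compose[OF h g] T relabel_closed[OF g relabel_closed[OF h T]]]
    by simp
qed

lemma relabel_Bij: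
  assumes "g permutes A"
  shows "relabel A g \<in> Bij (labellings A)"
proof -
  have "bij_betw (relabel A g) (labellings A) (labellings A)"
  proof (rule bij_betw_byWitness[where f' = "relabel A (inv' g)"])
    note inv = permutes_inv[OF assms]
    show "\<forall>T\<in>labellings A. relabel A (inv' g) (relabel A g T) = T"
      using relabel_comp[OF inv assms] permutes_inv_o(2)[OF assms] relabel_id by metis
    show "\<forall>T\<in>labellings A. relabel A g (relabel A (inv' g) T) = T"
      using relabel_comp[OF assms inv] permutes_inv_o(1)[OF assms] relabel_id by metis
  qed (use relabel_closed assms permutes_inv in blast)+
  then show ?thesis
    by (simp add: Bij_def relabel_def)
qed

lemma relabel_action:
  "group_action (sym_group m) (labellings {1..m}) (relabel {1..m})"
  unfolding group_action_def group_hom_def group_hom_axioms_def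
proof (intro conjI sym_group_is_group group_BijGroup homI)
  fix g h assume "g \<in> carrier (sym_group m)" "h \<in> carrier (sym_group m)"
  then have gh: "g permutes {1..m}" "h permutes {1..m}"
    by (simp_all add: sym_group_carrier)
  show "relabel {1..m} g \<in> carrier (BijGroup (labellings {1..m}))"
    using relabel_Bij[OF gh(1)] by (simp add: BijGroup_def)
  show "relabel {1..m} (g \<otimes>\<^bsub>sym_group m\<^esub> h) =
      relabel {1..m} g \<otimes>\<^bsub>BijGroup (labellings {1..m})\<^esub> relabel {1..m} h"
  proof
    fix T
    show "relabel {1..m} (g \<otimes>\<^bsub>sym_group m\<^esub> h) T =
        (relabel {1..m} g \<otimes>\<^bsub>BijGroup (labellings {1..m})\<^esub> relabel {1..m} h) T"
      using relabel_comp[OF gh, of T] relabel_Bij[OF gh(1)] relabel_Bij[OF gh(2)]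
      by (cases "T \<in> labellings {1..m}")
        (simp_all add: BijGroup_def sym_group_mult compose_def relabel_def[of _ "g \<circ> h"])
  qed
qed

text \<open>
  The fixed labellings are the maps equivariant for \<open>g\<close> on the points and conjugation by \<open>g\<close> on the
  labels. The \<open>k\<close>-th power of that conjugation is conjugation by \<open>g ^^ k\<close>, whose fixed points form
  the centralizer of \<open>g ^^ k\<close>.
\<close>
lemma card_invariants_relabel:
  assumes g: "g permutes {1..m}"
  shows "card (invariants (labellings {1..m}) (relabel {1..m}) g) =
    (\<Prod>k = 1..m. card (centralizer (sym_group m) (g [^]\<^bsub>sym_group m\<^esub> k)) ^ num_cycles {1..m} g k)"
proof -
  define c where "c k = card (centralizer (sym_group m) (g [^]\<^bsub>sym_group m\<^esub> k))" for k :: nat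
  define \<C> where "\<C> = {C. C \<subseteq> {1..m} \<and> cyclic_on g C}"
  have fin: "finite \<C>"
    by (simp add: \<C>_def)
  have conj: "conj_by g \<in> {p. p permutes {1..m}} \<rightarrow> {p. p permutes {1..m}}"
    using conj_by_permutes[OF g] by auto
  have "invariants (labellings {1..m}) (relabel {1..m}) g =
      {T \<in> {1..m} \<rightarrow>\<^sub>E {p. p permutes {1..m}}. \<forall>a\<in>{1..m}. T (g a) = conj_by g (T a)}"
    using relabel_eq_iff[OF g] by (auto simp: invariants_def labellings_def)
  then have "card (invariants (labellings {1..m}) (relabel {1..m}) g) =
      (\<Prod>C\<in>\<C>. card {p \<in> {p. p permutes {1..m}}. (conj_by g ^^ card C) p = p})"
    unfolding \<C>_def using card_equivariant_maps[OF g finite_atLeastAtMost conj] by (simp only:)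
  also have "\<dots> = (\<Prod>C\<in>\<C>. c (card C))"
  proof (rule prod.cong[OF refl])
    fix C
    have "(conj_by g ^^ card C) p = p \<longleftrightarrow> p \<circ> g ^^ card C = g ^^ card C \<circ> p" for p
      unfolding conj_by_funpow[OF permutes_bij[OF g]]
      by (rule conj_by_fixed_iff[OF bij_fn[OF permutes_bij[OF g]]])
    then have "{p \<in> {p. p permutes {1..m}}. (conj_by g ^^ card C) p = p} =
        centralizer (sym_group m) (g [^]\<^bsub>sym_group m\<^esub> card C)"
      unfolding centralizer_def sym_group_mult sym_group_pow sym_group_carrier by simp
    then show "card {p \<in> {p. p permutes {1..m}}. (conj_by g ^^ card C) p = p} = c (card C)"
      by (simp add: c_def)
  qed
  also have "\<dots> = (\<Prod>k = 1..m. \<Prod>C\<in>{C \<in> \<C>. card C = k}. c (card C))"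
  proof (rule prod.group[symmetric, OF fin])
    show "card ` \<C> \<subseteq> {1..m}"
    proof (rule image_subsetI)
      fix C assume "C \<in> \<C>"
      then have C: "C \<subseteq> {1..m}" "C \<noteq> {}" "finite C"
        using finite_cyclic_on[of g C] by (auto simp: \<C>_def cyclic_on_alldef)
      then show "card C \<in> {1..m}"
        using card_mono[OF _ C(1)] by (simp add: Suc_le_eq card_gt_0_iff)
    qed
  qed simp
  also have "\<dots> = (\<Prod>k = 1..m. c k ^ num_cycles {1..m} g k)"
    by (rule prod.cong) (simp_all add: num_cycles_eq[OF g] \<C>_def conj_assoc del: One_nat_def)
  finally show ?thesis
    by (simp add: c_def)
qed

section \<open>Right quasigroups with identity as labellings\<close>

text \<open>
  The structure on \<open>{0..m}\<close> with identity \<open>0\<close> whose right translation by \<open>a \<noteq> 0\<close> is the permutation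
  \<open>(0 a) T\<^sub>a\<close>. As \<open>T\<^sub>a\<close> fixes \<open>0\<close>, this translation sends \<open>0\<close> to \<open>a\<close>.
\<close>
definition labelled_op :: "(nat \<Rightarrow> nat \<Rightarrow> nat) \<Rightarrow> nat \<Rightarrow> nat \<Rightarrow> nat" where
  "labelled_op T x a = (if a = 0 then x else transpose 0 a (T a x))"

lemma bij_betw_iff_ex1:
  "bij_betw f A B \<longleftrightarrow> f ` A \<subseteq> B \<and> (\<forall>b\<in>B. \<exists>!x. x \<in> A \<and> f x = b)"
proof
  assume f: "bij_betw f A B"
  have "\<exists>!x. x \<in> A \<and> f x = b" if b: "b \<in> B" for b
  proof -
    obtain x where "x \<in> A" "f x = b"
      using f b by (auto simp: bij_betw_def)
    then show ?thesis
      using f by (intro ex1I[of _ x]) (auto simp: bij_betw_def inj_on_def)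
  qed
  then show "f ` A \<subseteq> B \<and> (\<forall>b\<in>B. \<exists>!x. x \<in> A \<and> f x = b)"
    using f by (auto simp: bij_betw_def)
next
  assume f: "f ` A \<subseteq> B \<and> (\<forall>b\<in>B. \<exists>!x. x \<in> A \<and> f x = b)"
  then have "inj_on f A"
    by (intro inj_onI) blast
  moreover have "B \<subseteq> f ` A"
  proof
    fix b assume "b \<in> B"
    then have "\<exists>!x. x \<in> A \<and> f x = b"
      using f by simp
    then show "b \<in> f ` A"
      by blast
  qed
  ultimately show "bij_betw f A B"
    using f by (auto simp: bij_betw_def)
qed

lemma labelled_op_in_rqi:
  assumes T: "T \<in> labellings {1..m}"
  shows "({0..m}, labelled_op T) \<in> rqi_of_order (Suc m)"
proof -
  have perm: "T a permutes {1..m}" if "a \<in> {1..m}" for a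
    using T that by (auto simp: labellings_def)
  have bij: "bij_betw (\<lambda>x. labelled_op T x a) {0..m} {0..m}" if a: "a \<in> {0..m}" for a
  proof (cases "a = 0")
    case True
    then show ?thesis
      using bij_betw_id[of "{0..m}"] by (simp add: labelled_op_def id_def)
  next
    case False
    then have "T a permutes {0..m}"
      using permutes_subset[OF perm[of a]] a by auto
    then have "transpose 0 a \<circ> T a permutes {0..m}"
      using a by (intro permutes_compose permutes_swap_id) auto
    then show ?thesis
      using permutes_imp_bij False by (fastforce simp: labelled_op_def comp_def)
  qed
  have "labelled_op T a 0 = a \<and> labelled_op T 0 a = a" if "a \<in> {0..m}" for a
    using permutes_not_in[OF perm[of a], of 0] that by (auto simp: labelled_op_def)
  moreover have "\<exists>!x. x \<in> {0..m} \<and> labelled_op T x a = b" "labelled_op T b a \<in> {0..m}"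
    if "a \<in> {0..m}" "b \<in> {0..m}" for a b
    using bij[OF that(1)] bij_betwE[OF bij[OF that(1)]] that(2)
    by (auto simp: bij_betw_iff_ex1)
  ultimately show ?thesis
    unfolding rqi_of_order_def right_quasigroup_with_identity_def right_quasigroup_def
    by (auto intro!: bexI[of _ 0])
qed

lemma right_translation_bij:
  assumes "right_quasigroup S f" "a \<in> S"
  shows "bij_betw (\<lambda>x. f x a) S S"
  using assms unfolding right_quasigroup_def bij_betw_iff_ex1 by blast

text \<open>
  Transport the structure to \<open>{0..m}\<close> by a bijection taking the identity to \<open>0\<close>. The right
  translation by \<open>a\<close> then sends \<open>0\<close> to \<open>a\<close>, so composing it with the transposition \<open>(0 a)\<close> gives a
  permutation that fixes \<open>0\<close>, and this is the label of \<open>a\<close>.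
\<close>
lemma rqi_isomorphic_labelled_op:
  assumes "(S, f) \<in> rqi_of_order (Suc m)"
  obtains T where "T \<in> labellings {1..m}" "isomorphic S f {0..m} (labelled_op T)"
proof -
  have S: "right_quasigroup S f" "finite S" "card S = Suc m"
    and "\<exists>e\<in>S. \<forall>a\<in>S. f e a = a \<and> f a e = a"
    using assms by (auto simp: rqi_of_order_def right_quasigroup_with_identity_def)
  then obtain e where e: "e \<in> S" "\<And>a. a \<in> S \<Longrightarrow> f e a = a \<and> f a e = a"
    by blast
  obtain h0 where h0: "bij_betw h0 (S - {e}) {1..m}"
    using finite_same_card_bij[of "S - {e}" "{1..m}"] S e(1) by auto
  define h where "h = h0(e := 0)"
  have "bij_betw h (S - {e}) {1..m}"
    using h0 bij_betw_cong[of "S - {e}" h h0] by (simp add: h_def)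
  then have "bij_betw h (insert e (S - {e})) (insert (h e) {1..m})"
    using notIn_Un_bij_betw3[of e "S - {e}" h "{1..m}"] by (simp add: h_def)
  moreover have "insert e (S - {e}) = S" "insert (h e) {1..m} = {0..m}"
    using e(1) by (auto simp: h_def)
  ultimately have h: "bij_betw h S {0..m}"
    by simp
  define k where "k = inv_into S h"
  have k: "bij_betw k {0..m} S" and hk: "\<And>x. x \<in> {0..m} \<Longrightarrow> h (k x) = x"
    and kh: "\<And>x. x \<in> S \<Longrightarrow> k (h x) = x"
    unfolding k_def using h bij_betw_inv_into[OF h]
    by (auto simp: bij_betw_inv_into_right bij_betw_inv_into_left)
  have k0: "k 0 = e"
    using kh[OF e(1)] by (simp add: h_def)
  define g where "g x a = h (f (k x) (k a))" for x a
  define T where "T = (\<lambda>a\<in>{1..m}. \<lambda>x. if x \<in> {0..m} then transpose 0 a (g x a) else x)"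
  have perm: "T a permutes {1..m}" if a: "a \<in> {1..m}" for a
  proof -
    have "bij_betw (\<lambda>x. f x (k a)) S S"
      using right_translation_bij[OF S(1)] k a by (auto dest: bij_betwE)
    from bij_betw_trans[OF bij_betw_trans[OF k this] h]
    have "bij_betw (\<lambda>x. g x a) {0..m} {0..m}"
      by (simp add: g_def comp_def)
    moreover have "bij_betw (transpose 0 a) {0..m} {0..m}"
      using a by (intro permutes_imp_bij permutes_swap_id) auto
    ultimately have "bij_betw (\<lambda>x. transpose 0 a (g x a)) {0..m} {0..m}"
      using bij_betw_trans[of "\<lambda>x. g x a"] by (simp add: comp_def)
    then have "bij_betw (T a) {0..m} {0..m}"
      using a bij_betw_cong[of "{0..m}" "T a" "\<lambda>x. transpose 0 a (g x a)"] by (simp add: T_def)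
    then have "T a permutes {0..m}"
      by (rule bij_imp_permutes) (use a in \<open>auto simp: T_def\<close>)
    moreover have "g 0 a = a"
      using e(2)[of "k a"] k a hk k0 by (auto simp: g_def dest: bij_betwE)
    then have "T a 0 = 0"
      using a by (simp add: T_def)
    ultimately show ?thesis
      using permutes_superset[of "T a" "{0..m}" "{1..m}"] by (auto simp: Suc_le_eq)
  qed
  have "T \<in> labellings {1..m}"
    using perm by (auto simp: labellings_def T_def)
  moreover have "h (f x y) = labelled_op T (h x) (h y)" if "x \<in> S" "y \<in> S" for x y
  proof (cases "y = e")
    case True
    then show ?thesis
      using e(2) that by (simp add: labelled_op_def h_def)
  next
    case False
    then have "h y \<noteq> 0"
      using kh[OF that(2)] k0 by metis
    then show ?thesis
      using that bij_betwE[OF h] kh by (auto simp: labelled_op_def T_def g_def)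
  qed
  ultimately show ?thesis
    using that h unfolding isomorphic_def by blast
qed

text \<open>
  Since \<open>\<sigma>\<close> conjugates \<open>(0 a)\<close> to \<open>(0 \<sigma>(a))\<close>, the transpositions cancel from the homomorphism
  condition.
\<close>
lemma labelled_op_conj:
  assumes "bij \<sigma>" "\<sigma> 0 = 0" "a \<noteq> 0"
  shows "\<sigma> (labelled_op T x a) = labelled_op T' (\<sigma> x) (\<sigma> a) \<longleftrightarrow> \<sigma> (T a x) = T' (\<sigma> a) (\<sigma> x)"
proof -
  have inj: "\<sigma> u = \<sigma> v \<longleftrightarrow> u = v" for u v
    using bij_is_inj[OF assms(1)] by (rule inj_eq)
  have zero: "\<sigma> u = 0 \<longleftrightarrow> u = 0" for u
    using inj[of u 0] assms(2) by simp
  have "\<sigma> (transpose 0 a y) = transpose 0 (\<sigma> a) (\<sigma> y)" for y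
    using assms(2) by (auto simp: transpose_def inj zero)
  then show ?thesis
    using assms(3) by (simp add: labelled_op_def zero inj_eq[OF inj_transpose])
qed

text \<open>
  An isomorphism must fix the identity \<open>0\<close>, so it restricts to a permutation of \<open>{1..m}\<close>; by
  \<open>labelled_op_conj\<close> being a homomorphism then means being compatible with the labels.
\<close>
lemma isomorphic_labelled_op_iff:
  assumes T: "T \<in> labellings {1..m}" and T': "T' \<in> labellings {1..m}"
  shows "isomorphic {0..m} (labelled_op T) {0..m} (labelled_op T') \<longleftrightarrow>
    (\<exists>\<sigma>. \<sigma> permutes {1..m} \<and> relabel {1..m} \<sigma> T = T')"
proof
  assume "\<exists>\<sigma>. \<sigma> permutes {1..m} \<and> relabel {1..m} \<sigma> T = T'"
  then obtain \<sigma> where \<sigma>: "\<sigma> permutes {1..m}" "relabel {1..m} \<sigma> T = T'"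
    by blast
  have \<sigma>0: "bij \<sigma>" "\<sigma> 0 = 0"
    using permutes_bij[OF \<sigma>(1)] permutes_not_in[OF \<sigma>(1), of 0] by auto
  have "\<sigma> (labelled_op T x a) = labelled_op T' (\<sigma> x) (\<sigma> a)" if "a \<in> {0..m}" for x a
  proof (cases "a = 0")
    case True
    then show ?thesis
      using \<sigma>0 by (simp add: labelled_op_def)
  next
    case False
    then have "T' (\<sigma> a) (\<sigma> x) = conj_by \<sigma> (T a) (\<sigma> x)"
      using relabel_eq_iff[OF \<sigma>(1) T T'] \<sigma>(2) that by auto
    then have "\<sigma> (T a x) = T' (\<sigma> a) (\<sigma> x)"
      using \<sigma>0 by (simp add: conj_by_def bij_is_inj)
    then show ?thesis
      using labelled_op_conj[OF \<sigma>0 False] by blast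
  qed
  moreover have "bij_betw \<sigma> {0..m} {0..m}"
    using permutes_subset[OF \<sigma>(1), of "{0..m}"] by (intro permutes_imp_bij) auto
  ultimately show "isomorphic {0..m} (labelled_op T) {0..m} (labelled_op T')"
    unfolding isomorphic_def by blast
next
  assume "isomorphic {0..m} (labelled_op T) {0..m} (labelled_op T')"
  then obtain h where h: "bij_betw h {0..m} {0..m}"
    and hom: "\<And>x a. x \<in> {0..m} \<Longrightarrow> a \<in> {0..m} \<Longrightarrow>
      h (labelled_op T x a) = labelled_op T' (h x) (h a)"
    unfolding isomorphic_def by blast
  \<comment> \<open>An isomorphism is only constrained on the carrier; outside it, a permutation has to be the identity.\<close>
  define \<sigma> where "\<sigma> x = (if x \<in> {0..m} then h x else x)" for x
  have "bij_betw \<sigma> {0..m} {0..m}"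
    using h bij_betw_cong[of "{0..m}" \<sigma> h] by (simp add: \<sigma>_def)
  then have \<sigma>0m: "\<sigma> permutes {0..m}"
    by (rule bij_imp_permutes) (simp add: \<sigma>_def)
  have T'p: "T' a permutes {1..m}" if "a \<in> {1..m}" for a
    using T' that by (auto simp: labellings_def)
  have Tp: "T a permutes {1..m}" if "a \<in> {1..m}" for a
    using T that by (auto simp: labellings_def)
  have \<sigma>_0: "\<sigma> 0 = 0"
  proof (rule ccontr)
    assume nz: "\<sigma> 0 \<noteq> 0"
    have b: "\<sigma> 0 \<in> {1..m}"
      using permutes_in_image[OF \<sigma>0m, of 0] nz by auto
    \<comment> \<open>The image of \<open>0\<close> is idempotent, but right translation by \<open>b \<noteq> 0\<close> sends \<open>0\<close>, and so not \<open>b\<close>, to \<open>b\<close>.\<close>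
    have "labelled_op T' (\<sigma> 0) (\<sigma> 0) = \<sigma> 0"
      using hom[of 0 0] by (simp add: \<sigma>_def labelled_op_def)
    then have "T' (\<sigma> 0) (\<sigma> 0) = 0"
      using nz by (auto simp: labelled_op_def transpose_def split: if_splits)
    then show False
      using permutes_in_image[OF T'p[OF b], of "\<sigma> 0"] b by simp
  qed
  have \<sigma>: "\<sigma> permutes {1..m}"
    using permutes_superset[OF \<sigma>0m, of "{1..m}"] \<sigma>_0 by (auto simp: Suc_le_eq)
  have "T' (\<sigma> a) = conj_by \<sigma> (T a)" if a: "a \<in> {1..m}" for a
  proof
    fix y
    define x where "x = inv' \<sigma> y"
    have y: "y = \<sigma> x"
      by (simp add: x_def permutes_inverses[OF \<sigma>])
    have "\<sigma> (T a x) = T' (\<sigma> a) (\<sigma> x)"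
    proof (cases "x \<in> {0..m}")
      case True
      moreover have "labelled_op T x a \<in> {0..m}"
        using labelled_op_in_rqi[OF T] True a
        by (auto simp: rqi_of_order_def right_quasigroup_with_identity_def right_quasigroup_def)
      ultimately have "\<sigma> (labelled_op T x a) = labelled_op T' (\<sigma> x) (\<sigma> a)"
        using hom[of x a] a by (simp add: \<sigma>_def)
      then show ?thesis
        using labelled_op_conj[OF permutes_bij[OF \<sigma>] \<sigma>_0, of a] a by simp
    next
      case False
      have "\<sigma> a \<in> {1..m}"
        using permutes_in_image[OF \<sigma>] a by simp
      then show ?thesis
        using False permutes_not_in[OF \<sigma>, of x] permutes_not_in[OF Tp[OF a], of x]
          permutes_not_in[OF T'p, of "\<sigma> a" x] by simp
    qed
    then show "T' (\<sigma> a) y = conj_by \<sigma> (T a) y"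
      by (simp add: y conj_by_def permutes_inverses[OF \<sigma>])
  qed
  then show "\<exists>\<sigma>. \<sigma> permutes {1..m} \<and> relabel {1..m} \<sigma> T = T'"
    using relabel_eq_iff[OF \<sigma> T T'] \<sigma> by blast
qed

text \<open>
  Every isomorphism class contains some \<open>labelled_op T\<close>, and the labellings whose structure lies in
  a given class form one orbit.
\<close>
lemma QG_eq_card_orbits:
  "QG (Suc m) = card (orbits (sym_group m) (labellings {1..m}) (relabel {1..m}))"
proof -
  let ?E = "labellings {1..m}" and ?r = "rqi_iso_rel (Suc m)"
  let ?str = "\<lambda>T. ({0..m}, labelled_op T)"
  let ?D = "\<lambda>c. {T \<in> ?E. ?str T \<in> c}"
  have eq: "equiv (rqi_of_order (Suc m)) ?r"
    by (rule equiv_rqi_iso_rel)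
  have D: "?D (?r `` {?str T}) = Group_Action.orbit (sym_group m) (relabel {1..m}) T"
    if "T \<in> ?E" for T
  proof (rule Set.set_eqI)
    fix T'
    have "T' \<in> ?D (?r `` {?str T}) \<longleftrightarrow>
        T' \<in> ?E \<and> isomorphic {0..m} (labelled_op T) {0..m} (labelled_op T')"
      using labelled_op_in_rqi that by (auto simp: rqi_iso_rel_def)
    also have "\<dots> \<longleftrightarrow> T' \<in> ?E \<and> (\<exists>g. g permutes {1..m} \<and> relabel {1..m} g T = T')"
      using isomorphic_labelled_op_iff[OF that] by blast
    also have "\<dots> \<longleftrightarrow> T' \<in> Group_Action.orbit (sym_group m) (relabel {1..m}) T"
      using relabel_closed[OF _ that] unfolding Group_Action.orbit_def sym_group_carrier by blast
    finally show "T' \<in> ?D (?r `` {?str T}) \<longleftrightarrow>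
        T' \<in> Group_Action.orbit (sym_group m) (relabel {1..m}) T" .
  qed
  have rep: "\<exists>T\<in>?E. c = ?r `` {?str T}" if c: "c \<in> rqi_of_order (Suc m) // ?r" for c
  proof -
    obtain S f where Sf: "(S, f) \<in> rqi_of_order (Suc m)" "c = ?r `` {(S, f)}"
      using c by (auto elim!: quotientE)
    obtain T where T: "T \<in> ?E" "isomorphic S f {0..m} (labelled_op T)"
      using rqi_isomorphic_labelled_op[OF Sf(1)] by blast
    then have "((S, f), ?str T) \<in> ?r"
      using Sf(1) labelled_op_in_rqi by (simp add: rqi_iso_rel_def)
    then show ?thesis
      using equiv_class_eq[OF eq] Sf(2) T(1) by blast
  qed
  have "bij_betw ?D (rqi_of_order (Suc m) // ?r)
      (orbits (sym_group m) ?E (relabel {1..m}))"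
    unfolding bij_betw_def
  proof
    show "inj_on ?D (rqi_of_order (Suc m) // ?r)"
    proof (rule inj_onI)
      fix c c' assume c: "c \<in> rqi_of_order (Suc m) // ?r" and c': "c' \<in> rqi_of_order (Suc m) // ?r"
        and "?D c = ?D c'"
      moreover obtain T where T: "T \<in> ?E" "c = ?r `` {?str T}"
        using rep[OF c] by blast
      then have "T \<in> ?D c"
        using equiv_class_self[OF eq labelled_op_in_rqi] by blast
      ultimately have "?str T \<in> c \<inter> c'"
        by blast
      then show "c = c'"
        using quotient_disj[OF eq c c'] by blast
    qed
    show "?D ` (rqi_of_order (Suc m) // ?r) = orbits (sym_group m) ?E (relabel {1..m})"
    proof (intro equalityI subsetI)
      fix X assume "X \<in> ?D ` (rqi_of_order (Suc m) // ?r)"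
      then show "X \<in> orbits (sym_group m) ?E (relabel {1..m})"
        using rep D by (fastforce simp: orbits_def)
    next
      fix X assume "X \<in> orbits (sym_group m) ?E (relabel {1..m})"
      then obtain T where "T \<in> ?E" "X = ?D (?r `` {?str T})"
        using D by (auto simp: orbits_def)
      then show "X \<in> ?D ` (rqi_of_order (Suc m) // ?r)"
        using quotientI[OF labelled_op_in_rqi] by blast
    qed
  qed
  then show ?thesis
    unfolding QG_def by (rule bij_betw_same_card)
qed

section \<open>Counting by conjugacy classes\<close>
lemma (in group) sum_conj_classes:
  assumes "finite (carrier G)"
    and "\<And>t x. t \<in> conj_classes G \<Longrightarrow> x \<in> t \<Longrightarrow> f x = F t"
  shows "(\<Sum>x\<in>carrier G. f x) = (\<Sum>t\<in>conj_classes G. of_nat (card t) * F t)"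
proof -
  have mem: "conj_class G x = t" if t: "t \<in> conj_classes G" and x: "x \<in> t" for t x
  proof -
    obtain z where z: "z \<in> carrier G" "t = conj_class G z"
      using t by (auto simp: conj_classes_def)
    obtain g where "g \<in> carrier G" "x = g \<otimes> z \<otimes> inv g"
      using x z(2) by (auto simp: conj_class_def)
    then show ?thesis
      using conj_class_conj z by simp
  qed
  have sub: "t \<subseteq> carrier G" if "t \<in> conj_classes G" for t
    using that by (auto simp: conj_classes_def conj_class_def)
  have fibre: "{x. x \<in> carrier G \<and> conj_class G x = t} = t" if "t \<in> conj_classes G" for t
    using mem[OF that] sub[OF that] conj_class_self by blast
  have "(\<Sum>x\<in>carrier G. f x) = (\<Sum>t\<in>conj_classes G. \<Sum>x | x \<in> carrier G \<and> conj_class G x = t. f x)"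
    by (rule sum.group[symmetric]) (use assms(1) in \<open>auto simp: conj_classes_def\<close>)
  also have "\<dots> = (\<Sum>t\<in>conj_classes G. \<Sum>x\<in>t. f x)"
    by (simp add: fibre)
  also have "\<dots> = (\<Sum>t\<in>conj_classes G. of_nat (card t) * F t)"
    by (rule sum.cong) (simp_all add: assms(2))
  finally show ?thesis .
qed

theorem theorem3p2:
  fixes n :: nat
  assumes "n \<ge> 1"
  shows "(of_nat (QG n) :: rat) =
    1 / of_nat (order (sym_group (n - 1))) *
    (\<Sum>t\<in>conj_classes (sym_group (n - 1)).
       of_nat (card t) *
       (\<Prod>k = 1..n - 1.
          of_nat (centralizer_order (sym_group (n - 1)) (class_power (sym_group (n - 1)) t k))
            ^ class_num_cycles {1..n - 1} t k))"
proof -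
  define m where "m = n - 1"
  have n: "n = Suc m"
    using assms by (simp add: m_def)
  define F where "F t = (\<Prod>k = 1..m. centralizer_order (sym_group m) (class_power (sym_group m) t k)
      ^ class_num_cycles {1..m} t k)" for t
  interpret S: group "sym_group m"
    by (rule sym_group_is_group)
  have fin: "finite (carrier (sym_group m))"
    by (simp add: sym_group_def finite_permutations)
  have finE: "finite (labellings {1..m})"
    unfolding labellings_def by (intro finite_PiE) (simp_all add: finite_permutations)
  have F: "card (invariants (labellings {1..m}) (relabel {1..m}) g) = F t"
    if t: "t \<in> conj_classes (sym_group m)" "g \<in> t" for t g
  proof -
    have g: "g \<in> carrier (sym_group m)"
      using t by (auto simp: conj_classes_def conj_class_def)
    have "centralizer_order (sym_group m) (class_power (sym_group m) t k) =
        card (centralizer (sym_group m) (g [^]\<^bsub>sym_group m\<^esub> k))" for k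
      unfolding S.class_power_eq[OF t] using g
      by (intro S.centralizer_order_eq S.conj_class_self) (auto simp: conj_classes_def)
    moreover have "g permutes {1..m}"
      using g by (simp add: sym_group_carrier)
    ultimately show ?thesis
      using card_invariants_relabel class_num_cycles_eq[OF t] by (simp add: F_def)
  qed
  have "QG n * order (sym_group m) =
      (\<Sum>g\<in>carrier (sym_group m). card (invariants (labellings {1..m}) (relabel {1..m}) g))"
    unfolding n QG_eq_card_orbits by (rule group_action.burnside[OF relabel_action fin finE])
  also have "\<dots> = (\<Sum>t\<in>conj_classes (sym_group m). card t * F t)"
    using S.sum_conj_classes[OF fin F] by simp
  finally have "(of_nat (QG n * order (sym_group m)) :: rat) =
      of_nat (\<Sum>t\<in>conj_classes (sym_group m). card t * F t)"
    by simp
  moreover have "order (sym_group m) > 0"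
    using S.order_gt_0_iff_finite fin by simp
  ultimately show ?thesis
    unfolding m_def[symmetric] by (simp add: F_def field_simps)
qed

end
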